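(* Over $\mathrm{ZF}$ alone (without assuming the Axiom of Choice), $P\,\mathrm{G}(\mathbf{Set})$ is not equivalent to $P\,\mathrm{G}(\mathbf 2)$ (as poset categories).
   Context: The category $\mathrm{G}(\mathbf{Set})$: objects are triples $(\alpha,U,X)$ with $U,X$ sets and $\alpha\subseteq U\times X$. A morphism $(\alpha,U,X)\to(\beta,V,Y)$ is a pair of functions $f\colon U\to V$, $g\colon Y\to X$ such that for all $u\in U$, $y\in Y$: if $(u,g(y))\in\alpha$ then $(f(u),y)\in\beta$. $\mathbf 2=\{0<1\}$ is the two-element Boolean algebra, and $\mathrm{G}(\mathbf 2)$ is the partial order of triples $(a,u,x)$ of elements of $\mathbf 2$ with $a\le u\wedge x$, where $(a,u,x)\le(b,v,y)$ iff $u\le v$, $y\le x$, and $a\wedge(u\wedge y)\le b\wedge(u\wedge y)$. The poset reflection $P(\mathbf C)$ of a category $\mathbf C$ is the partial order obtained by preordering the objects of $\mathbf C$ by $A\le B$ iff there exists a morphism $A\to B$, and then identifying $A$ and $B$ whenever $A\le B$ and $B\le A$. A poset is regarded as a category with at most one morphism between any two objects. *)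

theory Defs
  imports Main
begin

section \<open>Models of ZF\<close>

text \<open>First-order formulas over the signature of set theory, with named variables. They are needed
  because Separation and Replacement are schemas ranging over first-order formulas (with parameters)
  and not over arbitrary external predicates.\<close>

datatype fm = Mem nat nat | Eq nat nat | Neg fm | Conj fm fm | All nat fm

primrec sat :: "('m \<Rightarrow> 'm \<Rightarrow> bool) \<Rightarrow> (nat \<Rightarrow> 'm) \<Rightarrow> fm \<Rightarrow> bool" where
  "sat E e (Mem i j) = E (e i) (e j)"
| "sat E e (Eq i j) = (e i = e j)"
| "sat E e (Neg p) = (\<not> sat E e p)"
| "sat E e (Conj p q) = (sat E e p \<and> sat E e q)"
| "sat E e (All i p) = (\<forall>a. sat E (e(i := a)) p)"

text \<open>In the schemas the environment \<open>e\<close> supplies the parameters (the set \<open>A\<close> itself may be one of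
  them). In Separation variable 0 is the element tested; in Replacement variable 0 is the argument
  and variable 1 the value. There is no axiom of choice: by the completeness theorem, what holds
  in all these structures is what ZF alone proves, although HOL itself has a choice operator.\<close>

locale ZF_model =
  fixes E :: "'m \<Rightarrow> 'm \<Rightarrow> bool"
  assumes extensionality: "\<And>A B. (\<forall>x. E x A \<longleftrightarrow> E x B) \<Longrightarrow> A = B"
    and foundation: "\<And>A. \<exists>x. E x A \<Longrightarrow> \<exists>x. E x A \<and> \<not> (\<exists>t. E t x \<and> E t A)"
    and pairing: "\<And>x y. \<exists>P. \<forall>t. E t P \<longleftrightarrow> t = x \<or> t = y"
    and union: "\<And>A. \<exists>S. \<forall>t. E t S \<longleftrightarrow> (\<exists>B. E B A \<and> E t B)"
    and power_set: "\<And>A. \<exists>P. \<forall>B. E B P \<longleftrightarrow> (\<forall>t. E t B \<longrightarrow> E t A)"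
    and infinity: "\<exists>I. (\<exists>z. E z I \<and> \<not> (\<exists>t. E t z)) \<and>
      (\<forall>x. E x I \<longrightarrow> (\<exists>y. E y I \<and> (\<forall>t. E t y \<longleftrightarrow> E t x \<or> t = x)))"
    and separation: "\<And>p e A. \<exists>B. \<forall>x. E x B \<longleftrightarrow> E x A \<and> sat E (e(0 := x)) p"
    and replacement: "\<And>p e A. (\<forall>x. E x A \<longrightarrow> (\<exists>!y. sat E (e(0 := x, 1 := y)) p)) \<Longrightarrow>
      \<exists>B. \<forall>y. E y B \<longleftrightarrow> (\<exists>x. E x A \<and> sat E (e(0 := x, 1 := y)) p)"

text \<open>Ordered pairs (Kuratowski), relations and functions inside a structure \<open>E\<close>.\<close>

definition is_upair :: "('m \<Rightarrow> 'm \<Rightarrow> bool) \<Rightarrow> 'm \<Rightarrow> 'm \<Rightarrow> 'm \<Rightarrow> bool" where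
  "is_upair E p x y \<longleftrightarrow> (\<forall>t. E t p \<longleftrightarrow> t = x \<or> t = y)"

definition is_pair :: "('m \<Rightarrow> 'm \<Rightarrow> bool) \<Rightarrow> 'm \<Rightarrow> 'm \<Rightarrow> 'm \<Rightarrow> bool" where
  "is_pair E p x y \<longleftrightarrow> (\<forall>t. E t p \<longleftrightarrow> is_upair E t x x \<or> is_upair E t x y)"

definition pair_in :: "('m \<Rightarrow> 'm \<Rightarrow> bool) \<Rightarrow> 'm \<Rightarrow> 'm \<Rightarrow> 'm \<Rightarrow> bool" where
  "pair_in E r x y \<longleftrightarrow> (\<exists>p. is_pair E p x y \<and> E p r)"

definition is_rel :: "('m \<Rightarrow> 'm \<Rightarrow> bool) \<Rightarrow> 'm \<Rightarrow> 'm \<Rightarrow> 'm \<Rightarrow> bool" where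
  "is_rel E r U X \<longleftrightarrow> (\<forall>p. E p r \<longrightarrow> (\<exists>u x. E u U \<and> E x X \<and> is_pair E p u x))"

definition is_fun :: "('m \<Rightarrow> 'm \<Rightarrow> bool) \<Rightarrow> 'm \<Rightarrow> 'm \<Rightarrow> 'm \<Rightarrow> bool" where
  "is_fun E f U V \<longleftrightarrow> is_rel E f U V \<and> (\<forall>u. E u U \<longrightarrow> (\<exists>!v. pair_in E f u v))"

definition app :: "('m \<Rightarrow> 'm \<Rightarrow> bool) \<Rightarrow> 'm \<Rightarrow> 'm \<Rightarrow> 'm" where
  "app E f u = (THE v. pair_in E f u v)"

definition id_fun :: "('m \<Rightarrow> 'm \<Rightarrow> bool) \<Rightarrow> 'm \<Rightarrow> 'm" where
  "id_fun E U = (THE i. \<forall>p. E p i \<longleftrightarrow> (\<exists>u. E u U \<and> is_pair E p u u))"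

definition comp_fun :: "('m \<Rightarrow> 'm \<Rightarrow> bool) \<Rightarrow> 'm \<Rightarrow> 'm \<Rightarrow> 'm" where
  "comp_fun E g f =
    (THE h. \<forall>p. E p h \<longleftrightarrow> (\<exists>x y z. is_pair E p x z \<and> pair_in E f x y \<and> pair_in E g y z))"


section \<open>Categories, equivalence, poset reflection\<close>

record ('o, 'a) cat =
  obj :: "'o set"
  hom :: "'o \<Rightarrow> 'o \<Rightarrow> 'a set"
  ident :: "'o \<Rightarrow> 'a"
  comp :: "'a \<Rightarrow> 'a \<Rightarrow> 'a"

text \<open>Hom-sets need not be disjoint, so the action of a functor on arrows takes the domain and the
  codomain as additional arguments.\<close>

definition is_category :: "('o, 'a) cat \<Rightarrow> bool" where
  "is_category C \<longleftrightarrow>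
    (\<forall>A\<in>obj C. ident C A \<in> hom C A A) \<and>
    (\<forall>A\<in>obj C. \<forall>B\<in>obj C. \<forall>D\<in>obj C. \<forall>f\<in>hom C A B. \<forall>g\<in>hom C B D. comp C g f \<in> hom C A D) \<and>
    (\<forall>A\<in>obj C. \<forall>B\<in>obj C. \<forall>f\<in>hom C A B.
       comp C f (ident C A) = f \<and> comp C (ident C B) f = f) \<and>
    (\<forall>A\<in>obj C. \<forall>B\<in>obj C. \<forall>D\<in>obj C. \<forall>F\<in>obj C. \<forall>f\<in>hom C A B. \<forall>g\<in>hom C B D. \<forall>h\<in>hom C D F.
       comp C h (comp C g f) = comp C (comp C h g) f)"

definition is_functor ::
  "('o, 'a) cat \<Rightarrow> ('p, 'b) cat \<Rightarrow> ('o \<Rightarrow> 'p) \<Rightarrow> ('o \<Rightarrow> 'o \<Rightarrow> 'a \<Rightarrow> 'b) \<Rightarrow> bool" where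
  "is_functor C D Fo Fa \<longleftrightarrow>
    (\<forall>A\<in>obj C. Fo A \<in> obj D) \<and>
    (\<forall>A\<in>obj C. \<forall>B\<in>obj C. \<forall>f\<in>hom C A B. Fa A B f \<in> hom D (Fo A) (Fo B)) \<and>
    (\<forall>A\<in>obj C. Fa A A (ident C A) = ident D (Fo A)) \<and>
    (\<forall>A\<in>obj C. \<forall>B\<in>obj C. \<forall>K\<in>obj C. \<forall>f\<in>hom C A B. \<forall>g\<in>hom C B K.
       Fa A K (comp C g f) = comp D (Fa B K g) (Fa A B f))"

definition naturally_isomorphic ::
  "('o, 'a) cat \<Rightarrow> ('p, 'b) cat \<Rightarrow> ('o \<Rightarrow> 'p) \<Rightarrow> ('o \<Rightarrow> 'o \<Rightarrow> 'a \<Rightarrow> 'b) \<Rightarrow>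
    ('o \<Rightarrow> 'p) \<Rightarrow> ('o \<Rightarrow> 'o \<Rightarrow> 'a \<Rightarrow> 'b) \<Rightarrow> bool" where
  "naturally_isomorphic C D Fo Fa Go Ga \<longleftrightarrow>
    (\<exists>\<eta> \<theta>.
      (\<forall>A\<in>obj C. \<eta> A \<in> hom D (Fo A) (Go A) \<and> \<theta> A \<in> hom D (Go A) (Fo A) \<and>
         comp D (\<theta> A) (\<eta> A) = ident D (Fo A) \<and> comp D (\<eta> A) (\<theta> A) = ident D (Go A)) \<and>
      (\<forall>A\<in>obj C. \<forall>B\<in>obj C. \<forall>f\<in>hom C A B.
         comp D (Ga A B f) (\<eta> A) = comp D (\<eta> B) (Fa A B f)))"

definition equivalent_cats :: "('o, 'a) cat \<Rightarrow> ('p, 'b) cat \<Rightarrow> bool" where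
  "equivalent_cats C D \<longleftrightarrow>
    (\<exists>Fo Fa Go Ga. is_functor C D Fo Fa \<and> is_functor D C Go Ga \<and>
      naturally_isomorphic C C
        (\<lambda>A. Go (Fo A)) (\<lambda>A B f. Ga (Fo A) (Fo B) (Fa A B f)) (\<lambda>A. A) (\<lambda>A B f. f) \<and>
      naturally_isomorphic D D
        (\<lambda>A. Fo (Go A)) (\<lambda>A B f. Fa (Go A) (Go B) (Ga A B f)) (\<lambda>A. A) (\<lambda>A B f. f))"

text \<open>A partial order is given by its order relation \<open>r\<close>, in the sense of
  \<^const>\<open>Partial_order\<close>; its carrier is \<^term>\<open>Field r\<close>.\<close>

definition poset_cat :: "'p rel \<Rightarrow> ('p, unit) cat" where
  "poset_cat r = \<lparr>obj = Field r, hom = (\<lambda>a b. {_. (a, b) \<in> r}), ident = (\<lambda>_. ()),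
     comp = (\<lambda>_ _. ())\<rparr>"

definition hom_preorder :: "('o, 'a) cat \<Rightarrow> 'o rel" where
  "hom_preorder C = {(A, B). A \<in> obj C \<and> B \<in> obj C \<and> hom C A B \<noteq> {}}"

definition hom_equiv :: "('o, 'a) cat \<Rightarrow> 'o rel" where
  "hom_equiv C = hom_preorder C \<inter> (hom_preorder C)\<inverse>"

definition poset_reflection :: "('o, 'a) cat \<Rightarrow> 'o set rel" where
  "poset_reflection C = {(X, Y). X \<in> obj C // hom_equiv C \<and> Y \<in> obj C // hom_equiv C \<and>
     (\<exists>A\<in>X. \<exists>B\<in>Y. (A, B) \<in> hom_preorder C)}"


section \<open>The category \<open>G(Set)\<close> and the poset \<open>G(2)\<close>\<close>

text \<open>\<open>G_Set E\<close> is built from the sets and functions that live inside the structure \<open>E\<close>: objects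
  are triples \<open>(\<alpha>, U, X)\<close> of elements of the model, and both components of a morphism are functions
  in the sense of the model. Functors out of it (and out of its poset reflection) are arbitrary
  HOL functions, hence include all class functions definable in the model.\<close>

definition G_Set :: "('m \<Rightarrow> 'm \<Rightarrow> bool) \<Rightarrow> ('m \<times> 'm \<times> 'm, 'm \<times> 'm) cat" where
  "G_Set E = \<lparr>
     obj = {(\<alpha>, U, X). is_rel E \<alpha> U X},
     hom = (\<lambda>(\<alpha>, U, X) (\<beta>, V, Y). {(f, g). is_fun E f U V \<and> is_fun E g Y X \<and>
       (\<forall>u y. E u U \<longrightarrow> E y Y \<longrightarrow> pair_in E \<alpha> u (app E g y) \<longrightarrow> pair_in E \<beta> (app E f u) y)}),
     ident = (\<lambda>(\<alpha>, U, X). (id_fun E U, id_fun E X)),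
     comp = (\<lambda>(f', g') (f, g). (comp_fun E f' f, comp_fun E g g'))\<rparr>"

text \<open>The type \<^typ>\<open>bool\<close> is the two-element Boolean algebra, with \<open>False < True\<close>.\<close>

definition G_2_carrier :: "(bool \<times> bool \<times> bool) set" where
  "G_2_carrier = {(a, u, x). a \<le> inf u x}"

definition G_2 :: "(bool \<times> bool \<times> bool) rel" where
  "G_2 = {((a, u, x), (b, v, y)). (a, u, x) \<in> G_2_carrier \<and> (b, v, y) \<in> G_2_carrier \<and>
     u \<le> v \<and> y \<le> x \<and> inf a (inf u y) \<le> inf b (inf u y)}"


section \<open>Well-definedness\<close>

lemma G_2_iff:
  "((a, u, x), (b, v, y)) \<in> G_2 \<longleftrightarrow> (a \<longrightarrow> u \<and> x) \<and> (b \<longrightarrow> v \<and> y) \<and>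
     (u \<longrightarrow> v) \<and> (y \<longrightarrow> x) \<and> (a \<and> u \<and> y \<longrightarrow> b \<and> u \<and> y)"
  unfolding G_2_def G_2_carrier_def by (simp only: mem_Collect_eq case_prod_conv le_bool_def inf_bool_def)

lemma G_2_partial_order: "Partial_order G_2" "Field G_2 = G_2_carrier"
proof -
  have r: "(p, p) \<in> G_2" if "p \<in> G_2_carrier" for p
    using that by (cases p) (simp add: G_2_def)
  have "G_2 \<subseteq> G_2_carrier \<times> G_2_carrier"
    unfolding G_2_def by blast
  then have sub: "p \<in> G_2_carrier" "q \<in> G_2_carrier" if "(p, q) \<in> G_2" for p q
    using that by blast+
  show F: "Field G_2 = G_2_carrier"
    unfolding Field_def using r sub by blast
  have "trans G_2"
  proof (rule transI)
    fix p q w assume pq: "(p, q) \<in> G_2" and qw: "(q, w) \<in> G_2"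
    obtain a u x b v y c k z where eq: "p = (a, u, x)" "q = (b, v, y)" "w = (c, k, z)"
      by (cases p, cases q, cases w) blast
    show "(p, w) \<in> G_2"
      using pq qw unfolding eq G_2_iff by (elim conjE, intro conjI) (iprover+)
  qed
  moreover have "antisym G_2"
  proof (rule antisymI)
    fix p q assume pq: "(p, q) \<in> G_2" and qp: "(q, p) \<in> G_2"
    obtain a u x b v y where eq: "p = (a, u, x)" "q = (b, v, y)"
      by (cases p, cases q) blast
    have "a = b" "u = v" "x = y"
      using pq qp unfolding eq G_2_iff by iprover+
    then show "p = q" by (simp only: eq)
  qed
  moreover have "refl_on G_2_carrier G_2"
    by (rule refl_onI) (rule r)
  moreover have "G_2 \<subseteq> G_2_carrier \<times> G_2_carrier" by fact
  ultimately show "Partial_order G_2"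
    unfolding F partial_order_on_def preorder_on_def by (intro conjI)
qed

lemma poset_cat_is_category:
  assumes "Partial_order r" shows "is_category (poset_cat r)"
proof -
  have "refl_on (Field r) r" "trans r"
    using assms by (auto simp: partial_order_on_def preorder_on_def)
  then show ?thesis
    unfolding is_category_def poset_cat_def by (simp add: refl_on_def trans_def)
qed

lemma hom_preorder_props:
  assumes "is_category C"
  shows "refl_on (obj C) (hom_preorder C)" "trans (hom_preorder C)"
    "hom_preorder C \<subseteq> obj C \<times> obj C"
proof -
  show "refl_on (obj C) (hom_preorder C)"
    using assms unfolding is_category_def refl_on_def hom_preorder_def by blast
  show "trans (hom_preorder C)"
  proof (rule transI)
    fix A B D assume "(A, B) \<in> hom_preorder C" "(B, D) \<in> hom_preorder C"
    then obtain f g where "A \<in> obj C" "B \<in> obj C" "D \<in> obj C" "f \<in> hom C A B" "g \<in> hom C B D"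
      by (auto simp: hom_preorder_def)
    then have "comp C g f \<in> hom C A D"
      using assms unfolding is_category_def by blast
    with \<open>A \<in> obj C\<close> \<open>D \<in> obj C\<close> show "(A, D) \<in> hom_preorder C"
      by (auto simp: hom_preorder_def)
  qed
  show "hom_preorder C \<subseteq> obj C \<times> obj C"
    by (auto simp: hom_preorder_def)
qed

lemma equiv_hom_equiv:
  assumes "is_category C" shows "equiv (obj C) (hom_equiv C)"
proof -
  note P = hom_preorder_props[OF assms]
  have "trans (hom_equiv C)"
    unfolding hom_equiv_def using P(2) by (simp add: trans_Int)
  moreover have "sym (hom_equiv C)"
    unfolding hom_equiv_def by (rule sym_Int_converse)
  moreover have "refl_on (obj C) (hom_equiv C)" "hom_equiv C \<subseteq> obj C \<times> obj C"
    unfolding hom_equiv_def using P(1,3) by (auto simp: refl_on_def)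
  ultimately show ?thesis
    by (auto simp: equiv_def)
qed

lemma poset_reflection_partial_order:
  assumes "is_category C"
  shows "Partial_order (poset_reflection C)" "Field (poset_reflection C) = obj C // hom_equiv C"
proof -
  note P = hom_preorder_props[OF assms] and Q = equiv_hom_equiv[OF assms]
  have le: "(A, B) \<in> hom_preorder C"
    if "X \<in> obj C // hom_equiv C" "A \<in> X" "B \<in> X" for X A B
    using quotient_eq_iff[OF Q that(1) that(1) that(2) that(3)] by (auto simp: hom_equiv_def)
  have ne: "\<exists>A. A \<in> X" if "X \<in> obj C // hom_equiv C" for X
    using that Q by (metis in_quotient_imp_non_empty ex_in_conv)
  have refl: "(X, X) \<in> poset_reflection C" if "X \<in> obj C // hom_equiv C" for X
    using ne[OF that] le[OF that] that by (auto simp: poset_reflection_def)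
  show F: "Field (poset_reflection C) = obj C // hom_equiv C"
  proof
    show "Field (poset_reflection C) \<subseteq> obj C // hom_equiv C"
      by (auto simp: Field_def poset_reflection_def)
    show "obj C // hom_equiv C \<subseteq> Field (poset_reflection C)"
      using refl by (meson FieldI1 subsetI)
  qed
  have all: "(A, B) \<in> hom_preorder C"
    if "(X, Y) \<in> poset_reflection C" "A \<in> X" "B \<in> Y" for X Y A B
  proof -
    from that(1) obtain A' B' where *: "X \<in> obj C // hom_equiv C" "Y \<in> obj C // hom_equiv C"
      "A' \<in> X" "B' \<in> Y" "(A', B') \<in> hom_preorder C"
      by (auto simp: poset_reflection_def)
    with le[of X A A'] le[of Y B' B] that P(2) show ?thesis
      by (meson transD)
  qed
  have "trans (poset_reflection C)"
  proof (rule transI)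
    fix X Y Z assume XY: "(X, Y) \<in> poset_reflection C" and YZ: "(Y, Z) \<in> poset_reflection C"
    then have q: "X \<in> obj C // hom_equiv C" "Y \<in> obj C // hom_equiv C" "Z \<in> obj C // hom_equiv C"
      by (auto simp: poset_reflection_def)
    obtain A B D where "A \<in> X" "B \<in> Y" "D \<in> Z"
      using q ne by meson
    with all[OF XY] all[OF YZ] P(2) have "(A, D) \<in> hom_preorder C"
      by (meson transD)
    with q \<open>A \<in> X\<close> \<open>D \<in> Z\<close> show "(X, Z) \<in> poset_reflection C"
      by (auto simp: poset_reflection_def)
  qed
  moreover have "antisym (poset_reflection C)"
  proof (rule antisymI)
    fix X Y assume XY: "(X, Y) \<in> poset_reflection C" and YX: "(Y, X) \<in> poset_reflection C"
    then have q: "X \<in> obj C // hom_equiv C" "Y \<in> obj C // hom_equiv C"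
      by (auto simp: poset_reflection_def)
    obtain A B where AB: "A \<in> X" "B \<in> Y"
      using q ne by meson
    with all[OF XY] all[OF YX] have "(A, B) \<in> hom_equiv C"
      by (auto simp: hom_equiv_def)
    with quotient_eq_iff[OF Q q AB] show "X = Y" by simp
  qed
  moreover have "refl_on (Field (poset_reflection C)) (poset_reflection C)"
    using refl unfolding F refl_on_def by (auto simp: poset_reflection_def)
  ultimately show "Partial_order (poset_reflection C)"
    unfolding partial_order_on_def preorder_on_def by (auto intro: FieldI1 FieldI2)
qed

context ZF_model
begin

lemma is_upair_exists: "\<exists>p. is_upair E p x y"
  using pairing unfolding is_upair_def .

lemma is_upair_unique: "is_upair E p x y \<Longrightarrow> is_upair E q x y \<Longrightarrow> p = q"
  unfolding is_upair_def by (rule extensionality) simp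

lemma is_pair_exists: "\<exists>p. is_pair E p x y"
proof -
  obtain a where a: "is_upair E a x x" using is_upair_exists by blast
  obtain b where b: "is_upair E b x y" using is_upair_exists by blast
  obtain p where "\<And>t. E t p \<longleftrightarrow> t = a \<or> t = b" using pairing by blast
  then have "is_pair E p x y"
    unfolding is_pair_def using a b is_upair_unique by metis
  then show ?thesis ..
qed

lemma is_pair_unique: "is_pair E p x y \<Longrightarrow> is_pair E q x y \<Longrightarrow> p = q"
  unfolding is_pair_def by (rule extensionality) simp

lemma is_pair_inject:
  assumes "is_pair E p x y" "is_pair E p x' y'"
  shows "x = x'" "y = y'"
proof -
  obtain a where a: "is_upair E a x x" using is_upair_exists by blast
  obtain b where b: "is_upair E b x y" using is_upair_exists by blast
  obtain a' where a': "is_upair E a' x' x'" using is_upair_exists by blast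
  obtain b' where b': "is_upair E b' x' y'" using is_upair_exists by blast
  have mem: "E a p" "E b p" "E a' p" "E b' p"
    using assms a b a' b' by (auto simp: is_pair_def)
  then have c: "is_upair E a x' x' \<or> is_upair E a x' y'" "is_upair E b x' x' \<or> is_upair E b x' y'"
    "is_upair E a' x x \<or> is_upair E a' x y" "is_upair E b' x x \<or> is_upair E b' x y"
    using assms by (auto simp: is_pair_def)
  show "x = x'"
    using c(1) a by (auto simp: is_upair_def)
  with c(2,4) b b' show "y = y'"
    unfolding is_upair_def by metis
qed

lemma pair_in_iff: "is_pair E p x y \<Longrightarrow> pair_in E r x y \<longleftrightarrow> E p r"
  unfolding pair_in_def using is_pair_unique by blast

lemma rel_eqI:
  assumes "is_rel E r U X" "is_rel E s V Y" "\<And>x y. pair_in E r x y \<longleftrightarrow> pair_in E s x y"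
  shows "r = s"
proof (rule extensionality, intro allI)
  fix p show "E p r \<longleftrightarrow> E p s"
    using assms pair_in_iff unfolding is_rel_def by metis
qed

lemma pair_in_relD: "is_rel E r U X \<Longrightarrow> pair_in E r u x \<Longrightarrow> E u U \<and> E x X"
  unfolding is_rel_def pair_in_def using is_pair_inject by blast

lemma is_funD:
  assumes "is_fun E f U V" "E u U"
  shows "pair_in E f u v \<longleftrightarrow> app E f u = v" "E (app E f u) V"
proof -
  have ex: "\<exists>!v. pair_in E f u v" and r: "is_rel E f U V"
    using assms by (auto simp: is_fun_def)
  show *: "pair_in E f u v \<longleftrightarrow> app E f u = v" for v
    unfolding app_def using theI'[OF ex] ex by blast
  show "E (app E f u) V"
    using *[of "app E f u"] pair_in_relD[OF r] by blast
qed

lemma id_fun_props: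
  shows "pair_in E (id_fun E U) x y \<longleftrightarrow> E x U \<and> x = y" "is_fun E (id_fun E U) U U"
proof -
  define iff where "iff = (\<lambda>p q. Conj (Neg (Conj p (Neg q))) (Neg (Conj q (Neg p))))"
  define up where "up = (\<lambda>s t. All s (iff (Mem s t) (Eq s 0)))"
  have "\<exists>i. \<forall>p. E p i \<longleftrightarrow> (\<exists>u. E u U \<and> sat E ((\<lambda>_. U)(0 := u, 1 := p)) (All 2 (iff (Mem 2 1) (up 3 2))))"
  proof (rule replacement, intro allI impI)
    fix u
    have "sat E ((\<lambda>_. U)(0 := u, 1 := p)) (All 2 (iff (Mem 2 1) (up 3 2))) \<longleftrightarrow> is_pair E p u u" for p
      by (auto simp: iff_def up_def is_pair_def is_upair_def)
    then show "\<exists>!p. sat E ((\<lambda>_. U)(0 := u, 1 := p)) (All 2 (iff (Mem 2 1) (up 3 2)))"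
      using is_pair_exists is_pair_unique by metis
  qed
  moreover have "sat E ((\<lambda>_. U)(0 := u, 1 := p)) (All 2 (iff (Mem 2 1) (up 3 2))) \<longleftrightarrow> is_pair E p u u" for u p
    by (auto simp: iff_def up_def is_pair_def is_upair_def)
  ultimately obtain i where i: "\<forall>p. E p i \<longleftrightarrow> (\<exists>u. E u U \<and> is_pair E p u u)"
    by auto
  then have "id_fun E U = i"
    unfolding id_fun_def by (intro the_equality) (auto intro: extensionality)
  with i have mem: "E p (id_fun E U) \<longleftrightarrow> (\<exists>u. E u U \<and> is_pair E p u u)" for p
    by simp
  show *: "pair_in E (id_fun E U) x y \<longleftrightarrow> E x U \<and> x = y" for x y
    unfolding pair_in_def mem using is_pair_inject is_pair_exists by metis
  show "is_fun E (id_fun E U) U U"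
    unfolding is_fun_def * is_rel_def mem by auto
qed

lemma comp_fun_props:
  assumes f: "is_fun E f U V" and g: "is_fun E g V W"
  shows "pair_in E (comp_fun E g f) x z \<longleftrightarrow> E x U \<and> app E g (app E f x) = z"
    "is_fun E (comp_fun E g f) U W"
proof -
  define iff where "iff = (\<lambda>p q. Conj (Neg (Conj p (Neg q))) (Neg (Conj q (Neg p))))"
  define up where "up = (\<lambda>t x y. All 10 (iff (Mem 10 t) (Neg (Conj (Neg (Eq 10 x)) (Neg (Eq 10 y))))))"
  define pr where "pr = (\<lambda>p x y. All 9 (iff (Mem 9 p) (Neg (Conj (Neg (up 9 x x)) (Neg (up 9 x y))))))"
  define ex where "ex = (\<lambda>i p. Neg (All i (Neg p)))"
  define pin where "pin = (\<lambda>r x y. ex 8 (Conj (pr 8 x y) (Mem 8 r)))"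
  define \<phi> where "\<phi> = ex 4 (ex 5 (Conj (pr 1 0 5) (Conj (pin 2 0 4) (pin 3 4 5))))"
  define e where "e = (\<lambda>n::nat. if n = 2 then f else g)"
  have sat: "sat E (e(0 := x, 1 := p)) \<phi> \<longleftrightarrow>
      (\<exists>y z. is_pair E p x z \<and> pair_in E f x y \<and> pair_in E g y z)" for x p
  proof -
    have s_iff: "sat E e (iff p q) \<longleftrightarrow> (sat E e p \<longleftrightarrow> sat E e q)" for e p q
      by (auto simp: iff_def)
    have s_up: "sat E e (up t x y) \<longleftrightarrow> is_upair E (e t) (e x) (e y)"
      if "t < 10" "x < 10" "y < 10" for e t x y
      using that by (simp add: up_def s_iff is_upair_def)
    have s_pr: "sat E e (pr p x y) \<longleftrightarrow> is_pair E (e p) (e x) (e y)"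
      if "p < 9" "x < 9" "y < 9" for e p x y
      using that by (simp add: pr_def s_iff s_up is_pair_def)
    have s_ex: "sat E e (ex i p) \<longleftrightarrow> (\<exists>a. sat E (e(i := a)) p)" for e i p
      by (simp add: ex_def)
    have s_pin: "sat E e (pin r x y) \<longleftrightarrow> pair_in E (e r) (e x) (e y)"
      if "r < 8" "x < 8" "y < 8" for e r x y
      using that by (simp add: pin_def s_ex s_pr pair_in_def)
    show ?thesis
      by (simp add: \<phi>_def s_ex s_pr s_pin e_def)
  qed
  have sat': "sat E (e(0 := x, 1 := p)) \<phi> \<longleftrightarrow> is_pair E p x (app E g (app E f x))" if "E x U" for x p
    unfolding sat using is_funD[OF f that] is_funD[OF g] by metis
  have "\<exists>h. \<forall>p. E p h \<longleftrightarrow> (\<exists>x. E x U \<and> sat E (e(0 := x, 1 := p)) \<phi>)"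
    by (rule replacement) (use sat' is_pair_exists is_pair_unique in metis)
  then obtain h where H: "\<And>p. E p h \<longleftrightarrow> (\<exists>x. E x U \<and> sat E (e(0 := x, 1 := p)) \<phi>)"
    by blast
  have h': "E p h \<longleftrightarrow> (\<exists>x. E x U \<and> is_pair E p x (app E g (app E f x)))" for p
    unfolding H by (rule ex_cong1, rule conj_cong[OF refl], rule sat')
  have dom: "E x U" if "pair_in E f x y" for x y
    using f that pair_in_relD unfolding is_fun_def by blast
  have h: "E p h \<longleftrightarrow> (\<exists>x y z. is_pair E p x z \<and> pair_in E f x y \<and> pair_in E g y z)" for p
    unfolding H sat by (rule ex_cong1) (use dom in blast)
  have "comp_fun E g f = h"
    unfolding comp_fun_def using h by (intro the_equality) (auto intro: extensionality)
  with h' have mem: "E p (comp_fun E g f) \<longleftrightarrow> (\<exists>x. E x U \<and> is_pair E p x (app E g (app E f x)))" for p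
    by simp
  show *: "pair_in E (comp_fun E g f) x z \<longleftrightarrow> E x U \<and> app E g (app E f x) = z" for x z
    unfolding pair_in_def mem using is_pair_inject is_pair_exists by metis
  show "is_fun E (comp_fun E g f) U W"
    unfolding is_fun_def * is_rel_def mem
    using is_funD(2)[OF f] is_funD(2)[OF g] by blast
qed

lemma fun_eqI:
  assumes "is_fun E f U V" "is_fun E g U V" "\<And>u. E u U \<Longrightarrow> app E f u = app E g u"
  shows "f = g"
proof (rule rel_eqI)
  show "is_rel E f U V" "is_rel E g U V" using assms by (auto simp: is_fun_def)
  then show "pair_in E f x y \<longleftrightarrow> pair_in E g x y" for x y
    using pair_in_relD is_funD(1) assms by metis
qed

lemma app_id: "E u U \<Longrightarrow> app E (id_fun E U) u = u"
  using is_funD(1)[OF id_fun_props(2), of u U u] id_fun_props(1)[of U u u] by simp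

lemma app_comp:
  assumes "is_fun E f U V" "is_fun E g V W" "E u U"
  shows "app E (comp_fun E g f) u = app E g (app E f u)"
  using is_funD(1)[OF comp_fun_props(2)[OF assms(1,2)] assms(3), of "app E g (app E f u)"]
    comp_fun_props(1)[OF assms(1,2), of u "app E g (app E f u)"] assms(3) by simp

lemma G_Set_is_category: "is_category (G_Set E)"
proof -
  have id1: "comp_fun E f (id_fun E U) = f" if f: "is_fun E f U V" for f U V
  proof (rule fun_eqI[OF comp_fun_props(2)[OF id_fun_props(2) f] f])
    fix u assume u: "E u U"
    show "app E (comp_fun E f (id_fun E U)) u = app E f u"
      by (simp only: app_comp[OF id_fun_props(2) f u] app_id[OF u])
  qed
  have id2: "comp_fun E (id_fun E V) f = f" if f: "is_fun E f U V" for f U V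
  proof (rule fun_eqI[OF comp_fun_props(2)[OF f id_fun_props(2)] f])
    fix u assume u: "E u U"
    show "app E (comp_fun E (id_fun E V) f) u = app E f u"
      by (simp only: app_comp[OF f id_fun_props(2) u] app_id[OF is_funD(2)[OF f u]])
  qed
  have assoc: "comp_fun E h (comp_fun E g f) = comp_fun E (comp_fun E h g) f"
    if f: "is_fun E f U V" and g: "is_fun E g V W" and h: "is_fun E h W Z" for f g h U V W Z
  proof -
    note gf = comp_fun_props(2)[OF f g] and hg = comp_fun_props(2)[OF g h]
    show ?thesis
    proof (rule fun_eqI[OF comp_fun_props(2)[OF gf h] comp_fun_props(2)[OF f hg]])
      fix u assume u: "E u U"
      show "app E (comp_fun E h (comp_fun E g f)) u = app E (comp_fun E (comp_fun E h g) f) u"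
        by (simp only: app_comp[OF gf h u] app_comp[OF f g u] app_comp[OF f hg u]
            app_comp[OF g h is_funD(2)[OF f u]])
    qed
  qed
  show ?thesis
    unfolding is_category_def
  proof (intro conjI ballI)
    fix A assume "A \<in> obj (G_Set E)"
    then show "ident (G_Set E) A \<in> hom (G_Set E) A A"
      by (cases A) (auto simp: G_Set_def id_fun_props(2) app_id)
  next
    fix A B D f g
    assume fg: "f \<in> hom (G_Set E) A B" "g \<in> hom (G_Set E) B D"
    obtain \<alpha> U X \<beta> V Y \<gamma> W Z where ABD: "A = (\<alpha>, U, X)" "B = (\<beta>, V, Y)" "D = (\<gamma>, W, Z)"
      by (cases A, cases B, cases D) blast
    obtain f1 f2 g1 g2 where fg': "f = (f1, f2)" "g = (g1, g2)"
      by (cases f, cases g) blast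
    have F: "is_fun E f1 U V" "is_fun E f2 Y X" "is_fun E g1 V W" "is_fun E g2 Z Y"
      and mor: "\<And>u y. E u U \<Longrightarrow> E y Y \<Longrightarrow> pair_in E \<alpha> u (app E f2 y) \<Longrightarrow> pair_in E \<beta> (app E f1 u) y"
        "\<And>v z. E v V \<Longrightarrow> E z Z \<Longrightarrow> pair_in E \<beta> v (app E g2 z) \<Longrightarrow> pair_in E \<gamma> (app E g1 v) z"
      using fg unfolding ABD fg' by (auto simp: G_Set_def)
    show "comp (G_Set E) g f \<in> hom (G_Set E) A D"
      unfolding ABD fg' using F mor is_funD(2)[OF F(1)] is_funD(2)[OF F(4)]
      by (auto simp: G_Set_def app_comp[OF F(1,3)] app_comp[OF F(4,2)] intro: comp_fun_props(2))
  next
    fix A B f assume f: "f \<in> hom (G_Set E) A B"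
    obtain \<alpha> U X \<beta> V Y where AB: "A = (\<alpha>, U, X)" "B = (\<beta>, V, Y)"
      by (cases A, cases B) blast
    show "comp (G_Set E) f (ident (G_Set E) A) = f" "comp (G_Set E) (ident (G_Set E) B) f = f"
      using f unfolding AB by (auto simp: G_Set_def intro: id1 id2)
  next
    fix A B D K f g h
    assume fgh: "f \<in> hom (G_Set E) A B" "g \<in> hom (G_Set E) B D" "h \<in> hom (G_Set E) D K"
    obtain \<alpha> U X \<beta> V Y \<gamma> W Z \<delta> S T
      where "A = (\<alpha>, U, X)" "B = (\<beta>, V, Y)" "D = (\<gamma>, W, Z)" "K = (\<delta>, S, T)"
      by (cases A, cases B, cases D, cases K) blast
    with fgh show "comp (G_Set E) h (comp (G_Set E) g f) = comp (G_Set E) (comp (G_Set E) h g) f"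
      by (auto simp: G_Set_def intro: assoc assoc[symmetric])
  qed
qed

end

end

theory Submission
  imports Defs
begin

text \<open>
  The two posets differ in height. A strict chain in \<open>G(2)\<close> has at most four elements, because
  a rank with values in \<open>{0,1,2,3}\<close> increases at every strict inequality
  (\<open>G_2_rank_strict_mono\<close>). On the
  other side, writing \<open>0\<close>, \<open>1 = {0}\<close>, \<open>2 = {0,1}\<close> for the first von Neumann numerals, the category
  \<open>G(Set)\<close> contains
  \[ (\emptyset,0,1) < (\emptyset,1,1) < (=,2,2) < (=,1,1) < (\emptyset,1,0), \]
  a strict chain of five elements (\<open>G_Set_chain_of_five\<close>). An equivalence of poset reflections would carry it to a strict
  chain of five elements in \<open>G(2)\<close> (\<open>equivalent_reflections_order_embedding\<close>).

  The object responsible for the difference is \<open>(=,2,2)\<close>. For nonempty \<open>U,X,V,Y\<close> a morphism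
  \<open>(\<alpha>,U,X) \<rightarrow> (\<beta>,V,Y)\<close> with constant components exists as soon as some \<open>x\<close> is \<open>\<alpha>\<close>-related to no
  \<open>u\<close>, or some \<open>v\<close> is \<open>\<beta>\<close>-related to every \<open>y\<close>. The relations on nonempty sets that \<open>G(2)\<close> can
  describe, empty and full, both belong to these extremes, whereas equality on a set with two
  elements has neither feature and lies strictly between them. Indeed a morphism
  \<open>(=,U,U) \<rightarrow> (=,V,V)\<close> exhibits \<open>V\<close> as a retract of \<open>U\<close>.

  No choice is made inside the model: each set in the chain is explicit and has at most two elements,
  and all positive instances of the order are witnessed by constant functions. The argument therefore
  applies to every model of ZF, whether or not the Axiom of Choice holds in it.
\<close>

section \<open>Equivalences of poset reflections\<close>

lemma poset_functor_mono:
  assumes "is_functor (poset_cat r) (poset_cat s) F Fa" and ab: "(a, b) \<in> r"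
  shows "(F a, F b) \<in> s"
proof -
  have "() \<in> hom (poset_cat r) a b" "a \<in> obj (poset_cat r)" "b \<in> obj (poset_cat r)"
    using ab by (auto simp: poset_cat_def intro: FieldI1 FieldI2)
  then have "Fa a b () \<in> hom (poset_cat s) (F a) (F b)"
    using assms(1) unfolding is_functor_def by blast
  then show ?thesis
    by (simp add: poset_cat_def split: if_splits)
qed

text \<open>Natural transformations between functors into a poset are pointwise inequalities; the
  quasi-inverse together with the unit therefore pulls inequalities back along an equivalence.\<close>

lemma equivalent_poset_cats_order_embedding:
  assumes r: "Partial_order r" and eq: "equivalent_cats (poset_cat r) (poset_cat s)"
  obtains F where "\<And>a. a \<in> Field r \<Longrightarrow> F a \<in> Field s"
    and "\<And>a b. a \<in> Field r \<Longrightarrow> b \<in> Field r \<Longrightarrow> (a, b) \<in> r \<longleftrightarrow> (F a, F b) \<in> s"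
proof -
  from eq obtain F Fa G Ga
    where F: "is_functor (poset_cat r) (poset_cat s) F Fa"
      and G: "is_functor (poset_cat s) (poset_cat r) G Ga"
      and iso: "naturally_isomorphic (poset_cat r) (poset_cat r) (\<lambda>A. G (F A))
        (\<lambda>A B f. Ga (F A) (F B) (Fa A B f)) (\<lambda>A. A) (\<lambda>A B f. f)"
    unfolding equivalent_cats_def by blast
  have F_field: "F a \<in> Field s" if "a \<in> Field r" for a
    using F that by (simp add: is_functor_def poset_cat_def)
  have GF: "(a, G (F a)) \<in> r" "(G (F a), a) \<in> r" if "a \<in> Field r" for a
    using iso that by (auto simp: naturally_isomorphic_def poset_cat_def split: if_splits)
  have "trans r"
    using r by (simp add: partial_order_on_def preorder_on_def)
  then have "(a, b) \<in> r" if "a \<in> Field r" "b \<in> Field r" "(F a, F b) \<in> s" for a b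
    using poset_functor_mono[OF G that(3)] GF(1)[OF that(1)] GF(2)[OF that(2)] by (meson transD)
  with F_field poset_functor_mono[OF F] that show thesis by blast
qed

lemma poset_reflection_iff:
  assumes C: "is_category C"
    and XY: "X \<in> obj C // hom_equiv C" "Y \<in> obj C // hom_equiv C" and AB: "A \<in> X" "B \<in> Y"
  shows "(X, Y) \<in> poset_reflection C \<longleftrightarrow> (A, B) \<in> hom_preorder C"
proof
  assume "(X, Y) \<in> poset_reflection C"
  then obtain A' B' where A'B': "A' \<in> X" "B' \<in> Y" "(A', B') \<in> hom_preorder C"
    by (auto simp: poset_reflection_def)
  have "(A, A') \<in> hom_preorder C" "(B', B) \<in> hom_preorder C"
    using quotient_eq_iff[OF equiv_hom_equiv[OF C]] XY AB A'B' by (auto simp: hom_equiv_def)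
  with A'B'(3) show "(A, B) \<in> hom_preorder C"
    using hom_preorder_props(2)[OF C] by (meson transD)
qed (use XY AB in \<open>auto simp: poset_reflection_def\<close>)

text \<open>Choosing a representative of each class on the side of \<open>D\<close> turns the embedding of posets into
  a map between the objects themselves, so that the quotients can be left behind.\<close>

lemma equivalent_reflections_order_embedding:
  assumes C: "is_category C" and D: "is_category D"
    and eq: "equivalent_cats (poset_cat (poset_reflection C)) (poset_cat (poset_reflection D))"
  obtains F where "\<And>A B. A \<in> obj C \<Longrightarrow> B \<in> obj C \<Longrightarrow>
    (A, B) \<in> hom_preorder C \<longleftrightarrow> (F A, F B) \<in> hom_preorder D"
proof -
  note fieldC = poset_reflection_partial_order(2)[OF C]
    and fieldD = poset_reflection_partial_order(2)[OF D]
  obtain H where H: "\<And>X. X \<in> obj C // hom_equiv C \<Longrightarrow> H X \<in> obj D // hom_equiv D"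
    "\<And>X Y. X \<in> obj C // hom_equiv C \<Longrightarrow> Y \<in> obj C // hom_equiv C \<Longrightarrow>
      (X, Y) \<in> poset_reflection C \<longleftrightarrow> (H X, H Y) \<in> poset_reflection D"
    using equivalent_poset_cats_order_embedding[OF poset_reflection_partial_order(1)[OF C] eq]
    unfolding fieldC fieldD by blast
  define cl where "cl A = hom_equiv C `` {A}" for A
  define rep where "rep X = (SOME B. B \<in> X)" for X :: "'c set"
  have cl: "cl A \<in> obj C // hom_equiv C" "A \<in> cl A" if "A \<in> obj C" for A
    using that equiv_class_self[OF equiv_hom_equiv[OF C]] by (auto simp: cl_def intro: quotientI)
  have rep: "rep X \<in> X" if "X \<in> obj D // hom_equiv D" for X
    using in_quotient_imp_non_empty[OF equiv_hom_equiv[OF D] that]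
    by (auto simp: rep_def some_in_eq)
  show thesis
  proof (rule that[of "\<lambda>A. rep (H (cl A))"])
    fix A B assume AB: "A \<in> obj C" "B \<in> obj C"
    have "(A, B) \<in> hom_preorder C \<longleftrightarrow> (cl A, cl B) \<in> poset_reflection C"
      by (rule poset_reflection_iff[OF C, symmetric]) (use cl AB in auto)
    also have "\<dots> \<longleftrightarrow> (H (cl A), H (cl B)) \<in> poset_reflection D"
      by (rule H(2)) (use cl AB in auto)
    also have "\<dots> \<longleftrightarrow> (rep (H (cl A)), rep (H (cl B))) \<in> hom_preorder D"
      by (rule poset_reflection_iff[OF D]) (use H(1) cl AB rep in auto)
    finally show "(A, B) \<in> hom_preorder C \<longleftrightarrow> (rep (H (cl A)), rep (H (cl B))) \<in> hom_preorder D" .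
  qed
qed

lemma hom_preorder_poset_cat: "hom_preorder (poset_cat r) = r"
  by (auto simp: hom_preorder_def poset_cat_def intro: FieldI1 FieldI2)


section \<open>The height of \<open>G(2)\<close>\<close>

text \<open>The weight of \<open>x\<close> must exceed the weight of \<open>a\<close>, because passing from \<open>(1,1,1)\<close> to the top
  element \<open>(0,1,0)\<close> loses the contribution of \<open>a\<close>.\<close>

definition G_2_rank :: "bool \<times> bool \<times> bool \<Rightarrow> nat" where
  "G_2_rank = (\<lambda>(a, u, x). of_bool a + of_bool u + 2 * of_bool (\<not> x))"

lemma G_2_rank_strict_mono:
  assumes "(p, q) \<in> G_2" "(q, p) \<notin> G_2"
  shows "G_2_rank p < G_2_rank q"
  using assms by (cases p; cases q) (auto simp: G_2_iff G_2_rank_def of_bool_def)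

lemma G_2_rank_le_3: "(p, q) \<in> G_2 \<Longrightarrow> G_2_rank q \<le> 3"
  by (cases p; cases q) (auto simp: G_2_iff G_2_rank_def of_bool_def)


section \<open>A strict chain of five objects in \<open>G(Set)\<close>\<close>

context ZF_model
begin

lemma const_fun_exists:
  assumes v: "E v V"
  obtains f where "is_fun E f U V" "\<And>u. E u U \<Longrightarrow> app E f u = v"
proof -
  \<comment> \<open>\<open>\<phi>\<close> says that variable 1 is the pair of variable 0 and variable 2, the latter standing
    for \<open>v\<close>.\<close>
  define iff where "iff = (\<lambda>p q. Conj (Neg (Conj p (Neg q))) (Neg (Conj q (Neg p))))"
  define up where "up = (\<lambda>t x y. All 4 (iff (Mem 4 t) (Neg (Conj (Neg (Eq 4 x)) (Neg (Eq 4 y))))))"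
  define \<phi> where "\<phi> = All 3 (iff (Mem 3 1) (Neg (Conj (Neg (up 3 0 0)) (Neg (up 3 0 2)))))"
  have sat: "sat E ((\<lambda>_. v)(0 := u, 1 := p)) \<phi> \<longleftrightarrow> is_pair E p u v" for u p
    by (auto simp: \<phi>_def iff_def up_def is_pair_def is_upair_def)
  have "\<exists>f. \<forall>p. E p f \<longleftrightarrow> (\<exists>u. E u U \<and> sat E ((\<lambda>_. v)(0 := u, 1 := p)) \<phi>)"
    by (rule replacement) (use sat is_pair_exists is_pair_unique in metis)
  then obtain f where f: "\<And>p. E p f \<longleftrightarrow> (\<exists>u. E u U \<and> is_pair E p u v)"
    unfolding sat by blast
  have pair_in_f: "pair_in E f x y \<longleftrightarrow> E x U \<and> y = v" for x y
    unfolding pair_in_def f using is_pair_inject is_pair_exists by metis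
  have "is_fun E f U V"
    unfolding is_fun_def is_rel_def pair_in_f f using v by blast
  moreover have "app E f u = v" if "E u U" for u
    using is_funD(1)[OF calculation that] pair_in_f that by blast
  ultimately show thesis using that by blast
qed

lemma const_morphism:
  assumes obj: "is_rel E \<alpha> U X" "is_rel E \<beta> V Y" and "E v V" "E x X"
    and imp: "\<And>u y. E u U \<Longrightarrow> E y Y \<Longrightarrow> pair_in E \<alpha> u x \<Longrightarrow> pair_in E \<beta> v y"
  shows "((\<alpha>, U, X), (\<beta>, V, Y)) \<in> hom_preorder (G_Set E)"
proof -
  obtain f where "is_fun E f U V" "\<And>u. E u U \<Longrightarrow> app E f u = v"
    using const_fun_exists[OF \<open>E v V\<close>] by metis
  moreover obtain g where "is_fun E g Y X" "\<And>y. E y Y \<Longrightarrow> app E g y = x"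
    using const_fun_exists[OF \<open>E x X\<close>] by metis
  ultimately have "(f, g) \<in> hom (G_Set E) (\<alpha>, U, X) (\<beta>, V, Y)"
    using imp by (auto simp: G_Set_def)
  then show ?thesis
    using obj by (auto simp: hom_preorder_def G_Set_def)
qed

lemma G_Set_leE:
  assumes "((\<alpha>, U, X), (\<beta>, V, Y)) \<in> hom_preorder (G_Set E)"
  obtains f g where "is_fun E f U V" "is_fun E g Y X"
    "\<And>u y. E u U \<Longrightarrow> E y Y \<Longrightarrow> pair_in E \<alpha> u (app E g y) \<Longrightarrow> pair_in E \<beta> (app E f u) y"
  using assms by (auto simp: hom_preorder_def G_Set_def)

text \<open>Instantiating the condition on morphisms at \<open>u = g(y)\<close>, the only way in which its premise can
  hold.\<close>

lemma equality_leE: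
  assumes "((id_fun E U, U, U), (\<beta>, V, Y)) \<in> hom_preorder (G_Set E)"
  obtains f g where "is_fun E f U V" "is_fun E g Y U"
    "\<And>y. E y Y \<Longrightarrow> pair_in E \<beta> (app E f (app E g y)) y"
  using assms by (elim G_Set_leE) (metis id_fun_props(1) is_funD(2))

lemma equality_le_equality_imp_retract:
  assumes "((id_fun E U, U, U), (id_fun E V, V, V)) \<in> hom_preorder (G_Set E)"
  obtains f g where "is_fun E f U V" "is_fun E g V U" "\<And>y. E y V \<Longrightarrow> app E f (app E g y) = y"
  using assms by (elim equality_leE) (simp add: id_fun_props(1))

lemma G_Set_chain_of_five:
  obtains A B C D F where
    "(A, B) \<in> hom_preorder (G_Set E)" "(B, A) \<notin> hom_preorder (G_Set E)"
    and "(B, C) \<in> hom_preorder (G_Set E)" "(C, B) \<notin> hom_preorder (G_Set E)"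
    and "(C, D) \<in> hom_preorder (G_Set E)" "(D, C) \<notin> hom_preorder (G_Set E)"
    and "(D, F) \<in> hom_preorder (G_Set E)" "(F, D) \<notin> hom_preorder (G_Set E)"
proof -
  let ?le = "hom_preorder (G_Set E)"
  obtain zero where zero: "\<not> E t zero" for t
    using infinity by blast
  obtain one where one: "E t one \<longleftrightarrow> t = zero" for t
    using pairing[of zero zero] by auto
  obtain two where two: "E t two \<longleftrightarrow> t = zero \<or> t = one" for t
    using pairing[of zero one] by auto
  have "zero \<noteq> one"
    using zero one by metis
  have empty_rel: "is_rel E zero U X" "\<not> pair_in E zero u x" for U X u x
    using zero by (auto simp: is_rel_def pair_in_def)
  have eq_rel: "is_rel E (id_fun E U) U U" for U
    using id_fun_props(2) by (simp add: is_fun_def)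
  show thesis
  proof (rule that)
    show "((zero, zero, one), (zero, one, one)) \<in> ?le"
      by (rule const_morphism[of _ _ _ _ _ _ zero zero]) (auto simp: empty_rel one zero)
    show "((zero, one, one), (zero, zero, one)) \<notin> ?le"
      using is_funD(2) zero one by (metis G_Set_leE)
    show "((zero, one, one), (id_fun E two, two, two)) \<in> ?le"
      by (rule const_morphism[of _ _ _ _ _ _ zero zero]) (auto simp: empty_rel eq_rel one two)
    show "((id_fun E two, two, two), (zero, one, one)) \<notin> ?le"
      using empty_rel(2) one by (metis equality_leE)
    show "((id_fun E two, two, two), (id_fun E one, one, one)) \<in> ?le"
      by (rule const_morphism[of _ _ _ _ _ _ zero zero])
        (auto simp: eq_rel one two id_fun_props(1))
    show "((id_fun E one, one, one), (id_fun E two, two, two)) \<notin> ?le"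
    proof
      assume "((id_fun E one, one, one), (id_fun E two, two, two)) \<in> ?le"
      then obtain f g where g: "is_fun E g two one"
        and fg: "\<And>y. E y two \<Longrightarrow> app E f (app E g y) = y"
        using equality_le_equality_imp_retract by blast
      have "app E g zero = app E g one"
        using is_funD(2)[OF g] one two by metis
      then show False
        using fg two \<open>zero \<noteq> one\<close> by metis
    qed
    show "((id_fun E one, one, one), (zero, one, zero)) \<in> ?le"
      by (rule const_morphism[of _ _ _ _ _ _ zero zero]) (auto simp: empty_rel eq_rel one zero)
    show "((zero, one, zero), (id_fun E one, one, one)) \<notin> ?le"
      using is_funD(2) zero one by (metis G_Set_leE)
  qed
qed

end


section \<open>The two reflections are not equivalent\<close>

theorem theorem10:
  fixes E :: "'m \<Rightarrow> 'm \<Rightarrow> bool"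
  assumes "ZF_model E"
  shows "\<not> equivalent_cats (poset_cat (poset_reflection (G_Set E)))
           (poset_cat (poset_reflection (poset_cat G_2)))"
proof
  interpret ZF_model E by fact
  let ?le = "hom_preorder (G_Set E)"
  assume "equivalent_cats (poset_cat (poset_reflection (G_Set E)))
           (poset_cat (poset_reflection (poset_cat G_2)))"
  then obtain F where F: "\<And>A B. A \<in> obj (G_Set E) \<Longrightarrow> B \<in> obj (G_Set E) \<Longrightarrow>
      (A, B) \<in> ?le \<longleftrightarrow> (F A, F B) \<in> G_2"
    using equivalent_reflections_order_embedding[OF G_Set_is_category
        poset_cat_is_category[OF G_2_partial_order(1)]]
    unfolding hom_preorder_poset_cat by blast
  have step: "G_2_rank (F A) < G_2_rank (F B)" "G_2_rank (F B) \<le> 3"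
    if "(A, B) \<in> ?le" "(B, A) \<notin> ?le" for A B
  proof -
    have "A \<in> obj (G_Set E)" "B \<in> obj (G_Set E)"
      using that(1) by (auto simp: hom_preorder_def)
    then have "(F A, F B) \<in> G_2" "(F B, F A) \<notin> G_2"
      using F that by blast+
    then show "G_2_rank (F A) < G_2_rank (F B)" "G_2_rank (F B) \<le> 3"
      using G_2_rank_strict_mono G_2_rank_le_3 by blast+
  qed
  show False
  proof (rule G_Set_chain_of_five)
    fix A B C D K
    assume "(A, B) \<in> ?le" "(B, A) \<notin> ?le" "(B, C) \<in> ?le" "(C, B) \<notin> ?le"
      "(C, D) \<in> ?le" "(D, C) \<notin> ?le" "(D, K) \<in> ?le" "(K, D) \<notin> ?le"
    then have "G_2_rank (F A) < G_2_rank (F B)" "G_2_rank (F B) < G_2_rank (F C)"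
      "G_2_rank (F C) < G_2_rank (F D)" "G_2_rank (F D) < G_2_rank (F K)" "G_2_rank (F K) \<le> 3"
      using step by blast+
    then show False by linarith
  qed
qed

end
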